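(* Let $J=(J_{i,j})$ be a real symmetric $n\times n$ matrix with zero diagonal and largest eigenvalue $\lambda'_{\max}$, and let $K,\Delta,\xi_0>0$ be constants. For a parameter $p>0$ let $$H_k(x,y)=\sum_{i=1}^n\left(\frac K4(x_i^2+y_i^2)^2-\frac p2(x_i^2-y_i^2)+\frac\Delta2(x_i^2+y_i^2)\right)-\frac{\xi_0}{2}\sum_{i,j=1}^nJ_{i,j}(x_ix_j+y_iy_j),\quad (x,y)\in\mathbb{R}^{2n}.$$ There is an admissible threshold $\alpha_*>0$ for $(\beta,S)=(\Delta,\xi_0J)$ (see context) such that whenever $p>\max\{\alpha_*^2,\lambda'_{\max}\}$, if $(x,y)$ is a global minimum point of $H_k$, then $\operatorname{sgn}(x)$ minimizes the Ising energy $E(v)=-\frac12v^TJv$ over $v\in\{-1,1\}^n$.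
   Context: $\operatorname{sgn}$ is the componentwise sign. For $\beta>0$ and $S$ real symmetric with zero diagonal, a constant $\alpha_*>0$ is an admissible threshold for $(\beta,S)$ if for every $\alpha>\alpha_*$ the function $U(x)=\sum_{i=1}^n\frac14x_i^4+\frac{\beta-\alpha^2}{2}x^Tx-\frac12x^TSx$ on $\mathbb{R}^n$ has the properties: the signum vectors of its local minimum points form the set $\{-1,1\}^n$, and the signum vector of every global minimum point minimizes $-\frac12v^TSv$ over $\{-1,1\}^n$. Here $p$ is treated as a constant parameter. *)

theory Defs
  imports "HOL-Analysis.Analysis"
begin

text \<open>The class function \<^const>\<open>sgn\<close> on \<^typ>\<open>real^'n\<close> normalises a vector;
  the componentwise sign is needed here.\<close>

definition signum_vec :: "real^'n \<Rightarrow> real^'n" where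
  "signum_vec x = (\<chi> i. sgn (x $ i))"

definition sign_vectors :: "(real^'n) set" where
  "sign_vectors = {v. \<forall>i. v $ i \<in> {-1, 1}}"

definition ising_energy :: "real^'n^'n \<Rightarrow> real^'n \<Rightarrow> real" where
  "ising_energy S v = - (1/2) * (v \<bullet> (S *v v))"

definition minimizes_ising :: "real^'n^'n \<Rightarrow> real^'n \<Rightarrow> bool" where
  "minimizes_ising S v \<longleftrightarrow> is_arg_min (ising_energy S) (\<lambda>w. w \<in> sign_vectors) v"

definition local_minimum_point :: "('a::topological_space \<Rightarrow> real) \<Rightarrow> 'a \<Rightarrow> bool" where
  "local_minimum_point f x \<longleftrightarrow> (\<forall>\<^sub>F z in nhds x. f x \<le> f z)"

definition global_minimum_point :: "('a \<Rightarrow> real) \<Rightarrow> 'a \<Rightarrow> bool" where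
  "global_minimum_point f x \<longleftrightarrow> (\<forall>z. f x \<le> f z)"

definition is_eigenvalue :: "real^'n^'n \<Rightarrow> real \<Rightarrow> bool" where
  "is_eigenvalue A l \<longleftrightarrow> (\<exists>v. v \<noteq> 0 \<and> A *v v = l *\<^sub>R v)"

definition is_largest_eigenvalue :: "real^'n^'n \<Rightarrow> real \<Rightarrow> bool" where
  "is_largest_eigenvalue A l \<longleftrightarrow> is_eigenvalue A l \<and> (\<forall>m. is_eigenvalue A m \<longrightarrow> m \<le> l)"

definition U_potential :: "real \<Rightarrow> real^'n^'n \<Rightarrow> real \<Rightarrow> real^'n \<Rightarrow> real" where
  "U_potential \<beta> S \<alpha> x =
     (\<Sum>i\<in>UNIV. (1/4) * (x $ i)^4) + (\<beta> - \<alpha>^2) / 2 * (x \<bullet> x) - (1/2) * (x \<bullet> (S *v x))"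

definition admissible_threshold :: "real \<Rightarrow> real^'n^'n \<Rightarrow> real \<Rightarrow> bool" where
  "admissible_threshold \<beta> S \<alpha>s \<longleftrightarrow> \<alpha>s > 0 \<and>
     (\<forall>\<alpha>>\<alpha>s.
        signum_vec ` {x. local_minimum_point (U_potential \<beta> S \<alpha>) x} = sign_vectors \<and>
        (\<forall>x. global_minimum_point (U_potential \<beta> S \<alpha>) x \<longrightarrow> minimizes_ising S (signum_vec x)))"

definition H_k ::
  "real \<Rightarrow> real \<Rightarrow> real \<Rightarrow> real^'n^'n \<Rightarrow> real \<Rightarrow> (real^'n) \<times> (real^'n) \<Rightarrow> real" where
  "H_k K \<Delta> \<xi>0 J p = (\<lambda>(x, y).
     (\<Sum>i\<in>UNIV. K/4 * ((x $ i)^2 + (y $ i)^2)^2 - p/2 * ((x $ i)^2 - (y $ i)^2)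
                + \<Delta>/2 * ((x $ i)^2 + (y $ i)^2))
     - \<xi>0/2 * (\<Sum>i\<in>UNIV. \<Sum>j\<in>UNIV. J $ i $ j * (x $ i * x $ j + y $ i * y $ j)))"

end

theory Submission
  imports Defs
begin

text \<open>
  Setting \<open>y = 0\<close> changes \<open>H_k\<close> by minus a nonnegative quartic term and a quadratic form in \<open>y\<close>
  that is positive definite for large \<open>p\<close>; so at a global minimum \<open>y = 0\<close>, and after rescaling by
  \<open>sqrt K\<close> the point \<open>x\<close> is a global minimum of \<open>U\<close> with \<open>\<alpha> = sqrt p\<close>.

  For \<open>U\<close>, put \<open>a = \<alpha>\<^sup>2 - \<beta>\<close>, so that up to a constant
  \<open>U x = (\<Sum>i. ((x\<^sub>i)\<^sup>2 - a)\<^sup>2 / 4) - x \<bullet> S x / 2\<close>. A local minimum has no zero component since the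
  second difference of \<open>U\<close> in that direction would be negative. Minimising \<open>U\<close> over a box around
  \<open>sqrt a *\<^sub>R v\<close> yields an interior point for every sign vector \<open>v\<close>, because moving a boundary
  coordinate to \<open>sqrt a * v\<^sub>i\<close> lowers the quartic part by an amount of order \<open>a\<^sup>2\<close>
  and changes the coupling only by order \<open>a\<close>. At a global minimum \<open>x\<close> with signs \<open>v\<close>, comparison
  with \<open>sqrt a *\<^sub>R w\<close> shows that the Ising energy of \<open>v\<close> exceeds that of \<open>w\<close> by at most \<open>O(1 / a)\<close>,
  hence not at all once \<open>a\<close> is large, as there are only finitely many energy levels.
\<close>

section \<open>Bounding the coupling by the matrix entries\<close>

text \<open>One crude constant that serves both as a sup-norm bound for \<open>S *v x\<close> and as
  an upper bound for the quadratic form of \<open>S\<close>.\<close>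

definition entry_sum :: "real^'n^'n \<Rightarrow> real" where
  "entry_sum S = (\<Sum>i\<in>UNIV. \<Sum>j\<in>UNIV. \<bar>S $ i $ j\<bar>)"

lemma entry_sum_nonneg: "0 \<le> entry_sum S"
  unfolding entry_sum_def by (intro sum_nonneg) auto

lemma matrix_vector_component_le:
  fixes S :: "real^'n^'n"
  assumes "\<And>j. \<bar>x $ j\<bar> \<le> M"
  shows "\<bar>(S *v x) $ k\<bar> \<le> entry_sum S * M"
proof -
  have M: "0 \<le> M"
    using assms[of k] by linarith
  have "\<bar>(S *v x) $ k\<bar> \<le> (\<Sum>j\<in>UNIV. \<bar>S $ k $ j * x $ j\<bar>)"
    unfolding matrix_vector_mult_def by (simp add: sum_abs)
  also have "\<dots> \<le> (\<Sum>j\<in>UNIV. \<bar>S $ k $ j\<bar> * M)"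
    by (intro sum_mono) (simp add: abs_mult assms mult_left_mono)
  also have "\<dots> = (\<Sum>j\<in>UNIV. \<bar>S $ k $ j\<bar>) * M"
    by (simp add: sum_distrib_right)
  also have "\<dots> \<le> entry_sum S * M"
    unfolding entry_sum_def
    by (intro mult_right_mono M member_le_sum[where f = "\<lambda>i. \<Sum>j\<in>UNIV. \<bar>S $ i $ j\<bar>"])
      (auto intro: sum_nonneg)
  finally show ?thesis .
qed

lemma inner_matrix_vector_eq_sum:
  fixes S :: "real^'n^'n"
  shows "x \<bullet> (S *v y) = (\<Sum>i\<in>UNIV. \<Sum>j\<in>UNIV. S $ i $ j * (x $ i * y $ j))"
  unfolding inner_vec_def matrix_vector_mult_def
  by (simp add: sum_distrib_left mult_ac)

lemma inner_matrix_vector_le: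
  fixes S :: "real^'n^'n"
  shows "x \<bullet> (S *v x) \<le> entry_sum S * (x \<bullet> x)"
proof -
  have "S $ i $ j * (x $ i * x $ j) \<le> \<bar>S $ i $ j\<bar> * (x \<bullet> x)" for i j
  proof -
    have "\<bar>x $ i * x $ j\<bar> \<le> norm x * norm x"
      by (simp add: abs_mult component_le_norm_cart mult_mono')
    also have "\<dots> = x \<bullet> x"
      by (simp add: power2_norm_eq_inner flip: power2_eq_square)
    finally have "\<bar>S $ i $ j\<bar> * \<bar>x $ i * x $ j\<bar> \<le> \<bar>S $ i $ j\<bar> * (x \<bullet> x)"
      by (intro mult_left_mono) auto
    then show ?thesis
      by (metis abs_le_D1 abs_mult)
  qed
  then show ?thesis
    unfolding inner_matrix_vector_eq_sum entry_sum_def sum_distrib_right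
    by (intro sum_mono)
qed

lemma inner_matrix_vector_commute:
  fixes S :: "real^'n^'n"
  assumes "transpose S = S"
  shows "x \<bullet> (S *v y) = y \<bullet> (S *v x)"
  by (metis assms dot_lmul_matrix inner_commute transpose_matrix_vector)

lemma quadratic_form_add:
  fixes S :: "real^'n^'n"
  assumes "transpose S = S"
  shows "(x + y) \<bullet> (S *v (x + y)) = x \<bullet> (S *v x) + 2 * (y \<bullet> (S *v x)) + y \<bullet> (S *v y)"
  using inner_matrix_vector_commute[OF assms, of x y]
  by (simp add: matrix_vector_right_distrib inner_add_left inner_add_right)

section \<open>The potential as coupled double wells\<close>

text \<open>Completing the square in each coordinate separates the coupling from the wells, which
  for positive \<open>a\<close> have their bottoms at plus and minus \<open>sqrt a\<close>.\<close>

lemma U_potential_double_well: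
  fixes S :: "real^'n^'n"
  assumes "a = \<alpha>\<^sup>2 - \<beta>"
  shows "U_potential \<beta> S \<alpha> x = (\<Sum>i\<in>UNIV. ((x $ i)\<^sup>2 - a)\<^sup>2 / 4)
           - real CARD('n) * a\<^sup>2 / 4 - (x \<bullet> (S *v x)) / 2"
proof -
  have "(\<Sum>i\<in>UNIV. ((x $ i)\<^sup>2 - a)\<^sup>2 / 4)
      = (\<Sum>i\<in>UNIV. 1/4 * (x $ i)^4 - a/2 * (x $ i * x $ i) + a\<^sup>2 / 4)"
    by (intro sum.cong refl) (simp add: power2_eq_square power4_eq_xxxx field_simps)
  also have "\<dots> = (\<Sum>i\<in>UNIV. 1/4 * (x $ i)^4) - a/2 * (x \<bullet> x) + real CARD('n) * a\<^sup>2 / 4"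
    by (simp add: sum.distrib sum_subtractf inner_vec_def sum_distrib_left)
  finally show ?thesis
    unfolding U_potential_def assms by (simp add: field_simps)
qed

text \<open>Symmetry and the vanishing diagonal entry make the coupling form affine in coordinate
  \<open>k\<close>, so the shift contributes only a linear coupling term.\<close>

lemma U_potential_shift:
  fixes S :: "real^'n^'n"
  assumes "transpose S = S" "S $ k $ k = 0" "a = \<alpha>\<^sup>2 - \<beta>"
  shows "U_potential \<beta> S \<alpha> (x + axis k d) - U_potential \<beta> S \<alpha> x
    = (((x $ k + d)\<^sup>2 - a)\<^sup>2 - ((x $ k)\<^sup>2 - a)\<^sup>2) / 4 - d * (S *v x) $ k"
proof -
  have ax: "axis k d \<bullet> z = d * z $ k" for z :: "real^'n"
    by (simp add: inner_axis' )
  have "(S *v axis k d) $ k = 0"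
    using assms(2) by (simp add: matrix_vector_mult_def axis_def if_distrib cong: if_cong)
  then have q: "(x + axis k d) \<bullet> (S *v (x + axis k d)) = x \<bullet> (S *v x) + 2 * (d * (S *v x) $ k)"
    by (simp add: quadratic_form_add[OF assms(1)] ax)
  have "(\<Sum>i\<in>UNIV. (((x + axis k d) $ i)\<^sup>2 - a)\<^sup>2 / 4) - (\<Sum>i\<in>UNIV. ((x $ i)\<^sup>2 - a)\<^sup>2 / 4)
      = (\<Sum>i\<in>UNIV. if i = k then (((x $ k + d)\<^sup>2 - a)\<^sup>2 - ((x $ k)\<^sup>2 - a)\<^sup>2) / 4 else 0)"
    unfolding sum_subtractf[symmetric]
    by (intro sum.cong refl) (auto simp: axis_def diff_divide_distrib)
  then show ?thesis
    unfolding U_potential_double_well[OF assms(3)] q by (simp add: field_simps)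
qed

section \<open>Sign vectors of local minima\<close>

lemma local_minimum_component_nonzero:
  fixes S :: "real^'n^'n"
  assumes "transpose S = S" "S $ k $ k = 0" "\<alpha>\<^sup>2 - \<beta> > 0"
    and "local_minimum_point (U_potential \<beta> S \<alpha>) x"
  shows "x $ k \<noteq> 0"
proof
  assume zero: "x $ k = 0"
  define a where "a = \<alpha>\<^sup>2 - \<beta>"
  obtain e where e: "e > 0" "\<And>z. dist z x < e \<Longrightarrow> U_potential \<beta> S \<alpha> x \<le> U_potential \<beta> S \<alpha> z"
    using assms(4) unfolding local_minimum_point_def eventually_nhds_metric by blast
  have a: "a > 0"
    using assms(3) by (simp add: a_def)
  \<comment> \<open>The bound \<open>e / 2\<close> keeps both shifted points in the neighbourhood;
    the bound \<open>sqrt a\<close> makes \<open>t\<^sup>2 - 2 * a\<close> negative.\<close>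
  define t where "t = min (e / 2) (sqrt a)"
  have t: "0 < t" "t < e" "t \<le> sqrt a"
    using e(1) a by (auto simp: t_def)
  have "t\<^sup>2 \<le> (sqrt a)\<^sup>2"
    using t by (intro power_mono) auto
  then have t2: "t\<^sup>2 \<le> a" "0 < t\<^sup>2"
    using a t by auto
  have "dist (x + axis k d) x < e" if "\<bar>d\<bar> = t" for d
    using that t by (simp add: dist_norm norm_eq_sqrt_inner inner_axis_axis)
  then have "0 \<le> U_potential \<beta> S \<alpha> (x + axis k d) - U_potential \<beta> S \<alpha> x" if "\<bar>d\<bar> = t" for d
    using e(2) that by simp
  then have "0 \<le> ((d\<^sup>2 - a)\<^sup>2 - a\<^sup>2) / 4 - d * (S *v x) $ k" if "\<bar>d\<bar> = t" for d
    using that unfolding U_potential_shift[OF assms(1,2) a_def] zero by simp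
  \<comment> \<open>Adding the inequalities for opposite shifts cancels the linear coupling
    term.\<close>
  from this[of t] this[of "- t"] have "0 \<le> (t\<^sup>2 - a)\<^sup>2 - a\<^sup>2"
    using t(1) by (simp only: abs_minus_cancel abs_of_pos power2_minus) argo
  also have "\<dots> = t\<^sup>2 * (t\<^sup>2 - 2 * a)"
    by (simp add: power2_eq_square algebra_simps)
  also have "\<dots> < 0"
    using t2 a by (intro mult_pos_neg) auto
  finally show False by simp
qed

lemma sign_vector_cases: "v \<in> sign_vectors \<Longrightarrow> v $ i = 1 \<or> v $ i = - 1"
  by (auto simp: sign_vectors_def)

text \<open>Compactness gives a minimiser on a box that keeps every coordinate on the side of
  \<open>v\<close>; what remains is to keep it off the boundary.\<close>

lemma exists_local_minimum:
  fixes S :: "real^'n^'n"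
  assumes "transpose S = S" "\<And>i. S $ i $ i = 0" and v: "v \<in> sign_vectors"
    and a_def: "a = \<alpha>\<^sup>2 - \<beta>" and a: "16 * entry_sum S < a"
  obtains x where "local_minimum_point (U_potential \<beta> S \<alpha>) x" "signum_vec x = v"
proof -
  let ?U = "U_potential \<beta> S \<alpha>"
  define s where "s = sqrt a"
  have apos: "a > 0"
    using a entry_sum_nonneg[of S] by linarith
  have s: "s > 0" "s\<^sup>2 = a"
    using apos by (auto simp: s_def)
  \<comment> \<open>the box \<open>s / 2 \<le> v $ i * x $ i \<le> 2 * s\<close>\<close>
  define l u :: "real^'n" where "l = (\<chi> i. s * (5 * v $ i - 3) / 4)"
    and "u = (\<chi> i. s * (5 * v $ i + 3) / 4)"
  have "s *\<^sub>R v \<in> cbox l u"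
    unfolding mem_box_cart
  proof
    fix i
    show "l $ i \<le> (s *\<^sub>R v) $ i \<and> (s *\<^sub>R v) $ i \<le> u $ i"
      using sign_vector_cases[OF v, of i] s by (auto simp: l_def u_def)
  qed
  moreover have "continuous_on (cbox l u) ?U"
    unfolding U_potential_def by (intro continuous_intros)
  ultimately obtain x where x: "x \<in> cbox l u" and min: "\<And>z. z \<in> cbox l u \<Longrightarrow> ?U x \<le> ?U z"
    using continuous_attains_inf[OF compact_cbox, of l u ?U] by blast
  have xb: "l $ i \<le> x $ i" "x $ i \<le> u $ i" for i
    using x by (auto simp: mem_box_cart)
  have "\<bar>x $ i\<bar> \<le> 2 * s" for i
    using xb[of i] sign_vector_cases[OF v, of i] s by (auto simp: l_def u_def)
  then have Sx: "\<bar>(S *v x) $ k\<bar> \<le> entry_sum S * (2 * s)" for k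
    by (rule matrix_vector_component_le)
  have interior: "x $ k \<noteq> l $ k \<and> x $ k \<noteq> u $ k" for k
  proof (rule ccontr)
    assume "\<not> ?thesis"
    then have xk: "x $ k = v $ k * s / 2 \<or> x $ k = 2 * (v $ k * s)"
      using sign_vector_cases[OF v, of k] by (auto simp: l_def u_def)
    \<comment> \<open>This shift moves coordinate \<open>k\<close> to the bottom of its well without
      leaving the box.\<close>
    define d where "d = v $ k * s - x $ k"
    have "x + axis k d \<in> cbox l u"
      unfolding mem_box_cart
    proof
      fix i
      show "l $ i \<le> (x + axis k d) $ i \<and> (x + axis k d) $ i \<le> u $ i"
        using sign_vector_cases[OF v, of k] s xb[of i]
        by (cases "i = k") (auto simp: d_def l_def u_def axis_def)
    qed
    then have "0 \<le> ?U (x + axis k d) - ?U x"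
      using min by simp
    also have "\<dots> = - ((x $ k)\<^sup>2 - a)\<^sup>2 / 4 - d * (S *v x) $ k"
      using sign_vector_cases[OF v, of k] s
      by (auto simp: U_potential_shift[OF assms(1,2) a_def] d_def)
    finally have "0 \<le> - ((x $ k)\<^sup>2 - a)\<^sup>2 / 4 - d * (S *v x) $ k" .
    moreover have "- (d * (S *v x) $ k) \<le> s * (entry_sum S * (2 * s))"
    proof -
      have "\<bar>d\<bar> \<le> s"
        using xk sign_vector_cases[OF v, of k] s by (auto simp: d_def)
      then have "\<bar>d * (S *v x) $ k\<bar> \<le> s * (entry_sum S * (2 * s))"
        unfolding abs_mult using Sx s by (intro mult_mono) auto
      then show ?thesis by linarith
    qed
    moreover have "s * (entry_sum S * (2 * s)) = 2 * entry_sum S * a"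
      using s(2) by (simp add: power2_eq_square)
    ultimately have "((x $ k)\<^sup>2 - a)\<^sup>2 / 4 \<le> 2 * entry_sum S * a"
      by simp
    \<comment> \<open>The boundary values of the squared coordinate are \<open>a / 4\<close> and
      \<open>4 * a\<close>; the first is nearer to \<open>a\<close> and gives
      \<open>(3 * a / 4)\<^sup>2 / 4\<close>. The barrier beats the coupling because 16 exceeds 2 *
      64 / 9.\<close>
    moreover have "9 * a\<^sup>2 / 64 \<le> ((x $ k)\<^sup>2 - a)\<^sup>2 / 4"
    proof -
      have "(v $ k * s)\<^sup>2 = a"
        using sign_vector_cases[OF v, of k] s(2) by auto
      then have "(v $ k * s / 2)\<^sup>2 = a / 4" "(2 * (v $ k * s))\<^sup>2 = 4 * a"
        by (simp_all only: power_divide power_mult_distrib[of 2]) simp_all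
      then have "(x $ k)\<^sup>2 = a / 4 \<or> (x $ k)\<^sup>2 = 4 * a"
        using xk by metis
      then show ?thesis
        by (auto simp: power2_eq_square)
    qed
    moreover have "16 * entry_sum S * a < a\<^sup>2"
      using a apos by (simp add: power2_eq_square)
    moreover have "0 \<le> entry_sum S * a"
      using entry_sum_nonneg[of S] apos by simp
    ultimately show False
      by linarith
  qed
  have "x \<in> box l u"
    unfolding mem_box_cart
  proof
    fix i
    show "l $ i < x $ i \<and> x $ i < u $ i"
      using interior[of i] xb[of i] by auto
  qed
  then have "local_minimum_point ?U x"
    unfolding local_minimum_point_def eventually_nhds
    using min box_subset_cbox[of l u] by (intro exI[of _ "box l u"]) (auto simp: open_box)
  moreover have "signum_vec x = v"
  proof -
    have "sgn (x $ i) = v $ i" for i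
      using xb[of i] sign_vector_cases[OF v, of i] s by (auto simp: l_def u_def)
    then show ?thesis
      by (simp add: signum_vec_def vec_eq_iff)
  qed
  ultimately show ?thesis
    by (rule that)
qed

section \<open>Ising energy at global minima and the threshold\<close>

lemma ising_energy_near_minimal:
  fixes S :: "real^'n^'n"
  assumes "transpose S = S" and v: "v \<in> sign_vectors" and w: "w \<in> sign_vectors"
    and a_def: "a = \<alpha>\<^sup>2 - \<beta>" and a: "16 * entry_sum S < a"
    and min: "global_minimum_point (U_potential \<beta> S \<alpha>) x"
    and sgn: "\<And>i. sgn (x $ i) = v $ i"
  shows "a * (ising_energy S v - ising_energy S w) \<le> 2 * real CARD('n) * (entry_sum S)\<^sup>2"
proof -
  let ?C = "entry_sum S"
  have C: "?C \<ge> 0"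
    by (rule entry_sum_nonneg)
  define s where "s = sqrt a"
  have s: "s > 0" "s * s = a"
    using a C by (auto simp: s_def)
  define h where "h = x - s *\<^sub>R v"
  have x: "x = s *\<^sub>R v + h"
    by (simp add: h_def)
  have v2: "v $ i * v $ i = 1" and w2: "w $ i * w $ i = 1" and absv: "\<bar>v $ i\<bar> \<le> 1" for i
    using sign_vector_cases[OF v, of i] sign_vector_cases[OF w, of i] by auto
  \<comment> \<open>Equal signs give \<open>x $ i + s * v $ i\<close> an absolute value of at least
    \<open>s\<close>, so factoring \<open>(x $ i)\<^sup>2 - a\<close> yields a quadratic lower bound
    in the displacement \<open>h\<close>.\<close>
  have well: "a / 4 * (h $ i)\<^sup>2 \<le> ((x $ i)\<^sup>2 - a)\<^sup>2 / 4" for i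
  proof -
    have hx: "x $ i = s * v $ i + h $ i"
      by (simp add: h_def)
    have "(x $ i)\<^sup>2 - a = h $ i * (x $ i + s * v $ i)"
      using v2[of i] s(2) unfolding hx by algebra
    then have "((x $ i)\<^sup>2 - a)\<^sup>2 = (h $ i)\<^sup>2 * (x $ i + s * v $ i)\<^sup>2"
      by (simp add: power_mult_distrib)
    moreover have "a \<le> (x $ i + s * v $ i)\<^sup>2"
    proof -
      have "s\<^sup>2 \<le> (\<bar>x $ i\<bar> + s)\<^sup>2"
        using s by (intro power_mono) auto
      moreover have "\<bar>x $ i\<bar> + s = v $ i * (x $ i + s * v $ i)"
        using sgn[of i] v2[of i] by (simp add: algebra_simps abs_sgn)
      moreover have "(v $ i)\<^sup>2 = 1"
        using v2[of i] by (simp add: power2_eq_square)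
      ultimately show ?thesis
        using s(2) by (simp add: power_mult_distrib power2_eq_square[of s])
    qed
    ultimately have "(h $ i)\<^sup>2 * a \<le> ((x $ i)\<^sup>2 - a)\<^sup>2"
      by (simp add: mult_left_mono)
    then show ?thesis
      by (simp add: mult.commute)
  qed
  have lin: "h \<bullet> (S *v v) \<le> (\<Sum>i\<in>UNIV. ?C * \<bar>h $ i\<bar>)"
    unfolding inner_vec_def
  proof (intro sum_mono)
    fix i
    have "\<bar>(S *v v) $ i\<bar> * \<bar>h $ i\<bar> \<le> ?C * 1 * \<bar>h $ i\<bar>"
      by (intro mult_right_mono matrix_vector_component_le absv) auto
    then show "h $ i \<bullet> (S *v v) $ i \<le> ?C * \<bar>h $ i\<bar>"
      by (simp add: mult.commute) (metis abs_le_D1 abs_mult mult.commute)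
  qed
  have quad: "x \<bullet> (S *v x) = a * (v \<bullet> (S *v v)) + 2 * s * (h \<bullet> (S *v v)) + h \<bullet> (S *v h)"
    unfolding x quadratic_form_add[OF assms(1)]
    by (simp add: matrix_vector_mult_scaleR mult.assoc[symmetric] s(2))
  \<comment> \<open>The competitor lies at the bottom of every well, so only its coupling term
    survives, equal to \<open>a\<close> times the Ising energy of \<open>w\<close>.\<close>
  have "U_potential \<beta> S \<alpha> x \<le> U_potential \<beta> S \<alpha> (s *\<^sub>R w)"
    using min by (simp add: global_minimum_point_def)
  moreover have "((s * w $ i)\<^sup>2 - a)\<^sup>2 = 0" for i
    using w2[of i] s(2) by (simp only: power_mult_distrib) (simp add: power2_eq_square)
  moreover have "(s *\<^sub>R w) \<bullet> (S *v (s *\<^sub>R w)) = a * (w \<bullet> (S *v w))"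
    by (simp add: matrix_vector_mult_scaleR mult.assoc[symmetric] s(2))
  ultimately have "(\<Sum>i\<in>UNIV. ((x $ i)\<^sup>2 - a)\<^sup>2 / 4) - x \<bullet> (S *v x) / 2 \<le> - a * (w \<bullet> (S *v w)) / 2"
    unfolding U_potential_double_well[OF a_def] by simp
  moreover have "(\<Sum>i\<in>UNIV. a / 4 * (h $ i)\<^sup>2) \<le> (\<Sum>i\<in>UNIV. ((x $ i)\<^sup>2 - a)\<^sup>2 / 4)"
    by (intro sum_mono well)
  moreover have "s * (h \<bullet> (S *v v)) \<le> s * (\<Sum>i\<in>UNIV. ?C * \<bar>h $ i\<bar>)"
    using lin s by (intro mult_left_mono) auto
  moreover have "h \<bullet> (S *v h) \<le> ?C * (\<Sum>i\<in>UNIV. (h $ i)\<^sup>2)"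
    using inner_matrix_vector_le[of h S] by (simp add: inner_vec_def power2_eq_square)
  ultimately have "a * (ising_energy S v - ising_energy S w)
      \<le> s * (\<Sum>i\<in>UNIV. ?C * \<bar>h $ i\<bar>) + ?C * (\<Sum>i\<in>UNIV. (h $ i)\<^sup>2) / 2
        - (\<Sum>i\<in>UNIV. a / 4 * (h $ i)\<^sup>2)"
    unfolding quad ising_energy_def by (simp add: algebra_simps)
  also have "\<dots> = (\<Sum>i\<in>UNIV. s * ?C * \<bar>h $ i\<bar> + ?C / 2 * (h $ i)\<^sup>2 - a / 4 * (h $ i)\<^sup>2)"
    by (simp add: sum.distrib sum_subtractf sum_distrib_left mult.assoc sum_divide_distrib)
  also have "\<dots> \<le> (\<Sum>i\<in>(UNIV::'n set). 2 * ?C\<^sup>2)"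
  proof (intro sum_mono)
    fix i
    \<comment> \<open>Half of the available \<open>a / 4 * (h $ i)\<^sup>2\<close> pays for the
      linear term by completing the square, which fixes the factor 4; the other half absorbs the
      quadratic coupling.\<close>
    have "0 \<le> (s * \<bar>h $ i\<bar> - 4 * ?C)\<^sup>2"
      by simp
    also have "\<dots> = a * (h $ i)\<^sup>2 - 8 * (s * ?C * \<bar>h $ i\<bar>) + 16 * ?C\<^sup>2"
      using s(2) by (simp add: power2_diff power_mult_distrib power2_eq_square algebra_simps)
    finally have "s * ?C * \<bar>h $ i\<bar> \<le> a / 8 * (h $ i)\<^sup>2 + 2 * ?C\<^sup>2"
      by simp
    moreover have "?C / 2 * (h $ i)\<^sup>2 \<le> a / 8 * (h $ i)\<^sup>2"
      using a C by (intro mult_right_mono) auto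
    ultimately show "s * ?C * \<bar>h $ i\<bar> + ?C / 2 * (h $ i)\<^sup>2 - a / 4 * (h $ i)\<^sup>2 \<le> 2 * ?C\<^sup>2"
      by simp
  qed
  finally show ?thesis
    by simp
qed

lemma finite_sign_vectors: "finite (sign_vectors :: (real^'n) set)"
proof -
  have "(sign_vectors :: (real^'n) set) \<subseteq> (\<lambda>f. \<chi> i. f i) ` (UNIV \<rightarrow>\<^sub>E {- 1, 1 :: real})"
  proof
    fix v :: "real^'n" assume "v \<in> sign_vectors"
    then show "v \<in> (\<lambda>f. \<chi> i. f i) ` (UNIV \<rightarrow>\<^sub>E {- 1, 1})"
      by (intro image_eqI[of _ _ "\<lambda>i. v $ i"]) (auto simp: sign_vectors_def)
  qed
  then show ?thesis
    by (rule finite_subset) (auto intro!: finite_imageI finite_PiE)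
qed

text \<open>The least positive difference of values, capped at 1, is a gap below which no strict
  excess can fall.\<close>

lemma finite_image_gap:
  fixes f :: "'a \<Rightarrow> real"
  assumes "finite A"
  obtains g where "g > 0" "\<And>v w. v \<in> A \<Longrightarrow> w \<in> A \<Longrightarrow> f v - f w < g \<Longrightarrow> f v \<le> f w"
proof -
  let ?D = "{f v - f w | v w. v \<in> A \<and> w \<in> A \<and> f w < f v}"
  have "?D \<subseteq> (\<lambda>(v, w). f v - f w) ` (A \<times> A)"
    by auto
  then have fin: "finite ?D"
    by (rule finite_subset) (use assms in auto)
  \<comment> \<open>Inserting 1 keeps the minimum meaningful when \<open>f\<close> is constant on
    \<open>A\<close>.\<close>
  define g where "g = Min (insert 1 ?D)"
  have "g > 0"
    unfolding g_def using fin by (subst Min_gr_iff) auto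
  moreover have "f v \<le> f w" if "v \<in> A" "w \<in> A" "f v - f w < g" for v w
  proof (rule ccontr)
    assume "\<not> f v \<le> f w"
    then have "f v - f w \<in> ?D"
      using that by force
    then have "g \<le> f v - f w"
      unfolding g_def by (intro Min_le) (use fin in auto)
    then show False
      using that by simp
  qed
  ultimately show ?thesis
    by (rule that)
qed

text \<open>The free bound \<open>b\<close> lets the threshold be raised far enough to control the
  \<open>y\<close> part of \<open>H_k\<close> as well.\<close>

lemma exists_admissible_threshold:
  fixes S :: "real^'n^'n"
  assumes "transpose S = S" "\<And>i. S $ i $ i = 0" and "\<beta> > 0"
  obtains \<alpha>s where "admissible_threshold \<beta> S \<alpha>s" "b \<le> \<alpha>s\<^sup>2"
proof -
  obtain g where g: "g > 0"
    "\<And>v w. v \<in> sign_vectors \<Longrightarrow> w \<in> sign_vectors \<Longrightarrow>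
      ising_energy S v - ising_energy S w < g \<Longrightarrow> ising_energy S v \<le> ising_energy S w"
    using finite_image_gap[OF finite_sign_vectors, of "ising_energy S"] by blast
  \<comment> \<open>Chosen so that \<open>m < a\<close> pushes the energy error below the gap
    \<open>g\<close>.\<close>
  define m where "m = 2 * real CARD('n) * (entry_sum S)\<^sup>2 / g"
  have m: "m \<ge> 0"
    using g(1) by (simp add: m_def)
  \<comment> \<open>After subtracting \<open>\<beta>\<close>, the summands secure the barrier
    condition and the gap condition; the last one secures \<open>b\<close>.\<close>
  define \<alpha>s where "\<alpha>s = sqrt (\<beta> + 16 * entry_sum S + m + \<bar>b\<bar>)"
  have \<alpha>s: "\<alpha>s > 0" "\<alpha>s\<^sup>2 = \<beta> + 16 * entry_sum S + m + \<bar>b\<bar>"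
    using m assms(3) entry_sum_nonneg[of S] by (auto simp: \<alpha>s_def)
  have "signum_vec ` {x. local_minimum_point (U_potential \<beta> S \<alpha>) x} = sign_vectors \<and>
     (\<forall>x. global_minimum_point (U_potential \<beta> S \<alpha>) x \<longrightarrow> minimizes_ising S (signum_vec x))"
    if "\<alpha> > \<alpha>s" for \<alpha>
  proof -
    define a where "a = \<alpha>\<^sup>2 - \<beta>"
    have "\<alpha>s\<^sup>2 < \<alpha>\<^sup>2"
      using that \<alpha>s(1) by (intro power_strict_mono) auto
    then have a: "16 * entry_sum S < a" "m < a" "0 < a"
      using \<alpha>s(2) m entry_sum_nonneg[of S] by (auto simp: a_def)
    have signs: "signum_vec x \<in> sign_vectors"
      if "local_minimum_point (U_potential \<beta> S \<alpha>) x" for x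
      using local_minimum_component_nonzero[OF assms(1,2) a(3)[unfolded a_def] that]
      by (auto simp: sign_vectors_def signum_vec_def sgn_real_def)
    have "v \<in> signum_vec ` {x. local_minimum_point (U_potential \<beta> S \<alpha>) x}"
      if "v \<in> sign_vectors" for v
      using exists_local_minimum[OF assms(1,2) that a_def a(1)] by blast
    moreover have "minimizes_ising S (signum_vec x)"
      if x: "global_minimum_point (U_potential \<beta> S \<alpha>) x" for x
    proof -
      have v: "signum_vec x \<in> sign_vectors"
        using x by (intro signs) (simp add: local_minimum_point_def global_minimum_point_def)
      have "ising_energy S (signum_vec x) \<le> ising_energy S w" if w: "w \<in> sign_vectors" for w
      proof -
        have "a * (ising_energy S (signum_vec x) - ising_energy S w) \<le> m * g"
          using ising_energy_near_minimal[OF assms(1) v w a_def a(1) x] g(1)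
          by (simp add: signum_vec_def m_def)
        also have "\<dots> < a * g"
          using a g(1) by simp
        finally show ?thesis
          using g(2) v w a(3) by simp
      qed
      then show ?thesis
        unfolding minimizes_ising_def is_arg_min_linorder using v by simp
    qed
    ultimately show ?thesis
      using signs by blast
  qed
  then have "admissible_threshold \<beta> S \<alpha>s"
    using \<alpha>s(1) by (simp add: admissible_threshold_def)
  moreover have "b \<le> \<alpha>s\<^sup>2"
    using \<alpha>s(2) m assms(3) entry_sum_nonneg[of S] by linarith
  ultimately show ?thesis
    by (rule that)
qed

section \<open>Reduction of \<open>H_k\<close> to the potential \<open>U\<close>\<close>

lemma minimizes_ising_scaleR:
  assumes "c > 0"
  shows "minimizes_ising (c *\<^sub>R S) v \<longleftrightarrow> minimizes_ising S v"
proof -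
  have "ising_energy (c *\<^sub>R S) w = c * ising_energy S w" for w
    by (simp add: ising_energy_def scaleR_matrix_vector_assoc[symmetric])
  then show ?thesis
    using assms by (simp add: minimizes_ising_def is_arg_min_linorder)
qed

text \<open>Multiplying by \<open>K\<close> turns the quartic coefficient into
  \<open>K\<^sup>2 / 4\<close> and the quadratic ones into multiples of \<open>K\<close>, exactly
  what the scaling by \<open>sqrt K\<close> absorbs.\<close>

lemma H_k_zero_right:
  fixes J :: "real^'n^'n"
  assumes "K > 0" "p \<ge> 0"
  shows "K * H_k K \<Delta> \<xi>0 J p (x, 0) = U_potential \<Delta> (\<xi>0 *\<^sub>R J) (sqrt p) (sqrt K *\<^sub>R x)"
proof -
  define c where "c = sqrt K"
  have K: "K = c\<^sup>2"
    using assms(1) by (simp add: c_def)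
  have "(\<Sum>i\<in>UNIV. K/4 * ((x $ i)\<^sup>2)\<^sup>2 - p/2 * (x $ i)\<^sup>2 + \<Delta>/2 * (x $ i)\<^sup>2)
      = K / 4 * (\<Sum>i\<in>UNIV. (x $ i)^4) + (\<Delta> - p) / 2 * (x \<bullet> x)"
    by (simp add: sum.distrib sum_subtractf sum_distrib_left inner_vec_def power2_eq_square
        power4_eq_xxxx algebra_simps diff_divide_distrib)
  then show ?thesis
    using assms unfolding c_def[symmetric]
    by (simp add: H_k_def U_potential_def power_mult_distrib matrix_vector_mult_scaleR
        scaleR_matrix_vector_assoc[symmetric] inner_matrix_vector_eq_sum[symmetric]
        sum_distrib_left[symmetric] sum_divide_distrib[symmetric])
      (simp add: K algebra_simps power2_eq_square power4_eq_xxxx)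
qed

text \<open>The quartic term only grows with \<open>y\<close>, and the \<open>p\<close> term enters
  with opposite signs in \<open>x\<close> and \<open>y\<close>, so \<open>p\<close> adds to
  \<open>\<Delta>\<close> here.\<close>

lemma H_k_diff_zero_right:
  fixes J :: "real^'n^'n"
  assumes "K \<ge> 0"
  shows "(p + \<Delta>) / 2 * (y \<bullet> y) - (y \<bullet> ((\<xi>0 *\<^sub>R J) *v y)) / 2
    \<le> H_k K \<Delta> \<xi>0 J p (x, y) - H_k K \<Delta> \<xi>0 J p (x, 0)"
proof -
  have "(p + \<Delta>) / 2 * (y \<bullet> y) = (\<Sum>i\<in>UNIV. (p + \<Delta>) / 2 * (y $ i)\<^sup>2)"
    by (simp add: inner_vec_def sum_distrib_left power2_eq_square)
  also have "\<dots> \<le> (\<Sum>i\<in>UNIV. (K/4 * ((x $ i)\<^sup>2 + (y $ i)\<^sup>2)\<^sup>2 - p/2 * ((x $ i)\<^sup>2 - (y $ i)\<^sup>2)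
                + \<Delta>/2 * ((x $ i)\<^sup>2 + (y $ i)\<^sup>2))
      - (K/4 * ((x $ i)\<^sup>2)\<^sup>2 - p/2 * (x $ i)\<^sup>2 + \<Delta>/2 * (x $ i)\<^sup>2))"
  proof (intro sum_mono)
    fix i
    have "K/4 * ((x $ i)\<^sup>2)\<^sup>2 \<le> K/4 * ((x $ i)\<^sup>2 + (y $ i)\<^sup>2)\<^sup>2"
      using assms by (intro mult_left_mono power_mono) auto
    then show "(p + \<Delta>) / 2 * (y $ i)\<^sup>2
        \<le> (K/4 * ((x $ i)\<^sup>2 + (y $ i)\<^sup>2)\<^sup>2 - p/2 * ((x $ i)\<^sup>2 - (y $ i)\<^sup>2)
            + \<Delta>/2 * ((x $ i)\<^sup>2 + (y $ i)\<^sup>2))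
          - (K/4 * ((x $ i)\<^sup>2)\<^sup>2 - p/2 * (x $ i)\<^sup>2 + \<Delta>/2 * (x $ i)\<^sup>2)"
      by (simp add: field_simps)
  qed
  finally show ?thesis
    by (simp add: H_k_def sum_subtractf distrib_left sum.distrib
        scaleR_matrix_vector_assoc[symmetric] inner_matrix_vector_eq_sum)
qed

theorem proposition3p6:
  fixes J :: "real^'n^'n" and K \<Delta> \<xi>0 lmax :: real
  assumes "transpose J = J"
    and "\<And>i. J $ i $ i = 0"
    and "is_largest_eigenvalue J lmax"
    and "K > 0" and "\<Delta> > 0" and "\<xi>0 > 0"
  shows "\<exists>\<alpha>s. admissible_threshold \<Delta> (\<xi>0 *\<^sub>R J) \<alpha>s \<and>
           (\<forall>p>0. p > max (\<alpha>s^2) lmax \<longrightarrow>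
              (\<forall>x y. global_minimum_point (H_k K \<Delta> \<xi>0 J p) (x, y) \<longrightarrow>
                     minimizes_ising J (signum_vec x)))"
proof -
  let ?S = "\<xi>0 *\<^sub>R J"
  have "transpose ?S = ?S"
    using assms(1) by (simp add: transpose_scalar)
  \<comment> \<open>With \<open>b\<close> equal to the entry sum, every \<open>p\<close> above
    \<open>\<alpha>s\<^sup>2\<close> dominates the coupling form in \<open>y\<close>.\<close>
  then obtain \<alpha>s where adm: "admissible_threshold \<Delta> ?S \<alpha>s" and b: "entry_sum ?S \<le> \<alpha>s\<^sup>2"
    using exists_admissible_threshold[of ?S \<Delta> "entry_sum ?S"] assms(2,5) by auto
  have "minimizes_ising J (signum_vec x)"
    if p: "p > 0" "p > \<alpha>s\<^sup>2" and min: "global_minimum_point (H_k K \<Delta> \<xi>0 J p) (x, y)" for p x y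
  proof -
    have "y = 0"
    proof (rule ccontr)
      assume "y \<noteq> 0"
      then have "entry_sum ?S * (y \<bullet> y) < (p + \<Delta>) * (y \<bullet> y)"
        using p b assms(5) by (intro mult_strict_right_mono) auto
      then have "0 < (p + \<Delta>) / 2 * (y \<bullet> y) - (y \<bullet> (?S *v y)) / 2"
        using inner_matrix_vector_le[of y ?S] by simp
      also have "\<dots> \<le> H_k K \<Delta> \<xi>0 J p (x, y) - H_k K \<Delta> \<xi>0 J p (x, 0)"
        using assms(4) by (intro H_k_diff_zero_right) simp
      also have "\<dots> \<le> 0"
        using min by (simp add: global_minimum_point_def)
      finally show False by simp
    qed
    have "U_potential \<Delta> ?S (sqrt p) (sqrt K *\<^sub>R x) \<le> U_potential \<Delta> ?S (sqrt p) z" for z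
    proof -
      have "K * H_k K \<Delta> \<xi>0 J p (x, 0) \<le> K * H_k K \<Delta> \<xi>0 J p ((1 / sqrt K) *\<^sub>R z, 0)"
        using min \<open>y = 0\<close> assms(4) by (simp add: global_minimum_point_def)
      then show ?thesis
        using assms(4) p by (simp add: H_k_zero_right)
    qed
    then have "global_minimum_point (U_potential \<Delta> ?S (sqrt p)) (sqrt K *\<^sub>R x)"
      by (simp add: global_minimum_point_def)
    moreover have "\<alpha>s < sqrt p"
      using p by (simp add: real_less_rsqrt)
    ultimately have "minimizes_ising ?S (signum_vec (sqrt K *\<^sub>R x))"
      using adm by (simp add: admissible_threshold_def)
    moreover have "signum_vec (sqrt K *\<^sub>R x) = signum_vec x"
      using assms(4) by (simp add: signum_vec_def sgn_mult)
    ultimately show ?thesis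
      using assms(6) by (simp add: minimizes_ising_scaleR)
  qed
  then show ?thesis
    using adm by auto
qed

end
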